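(* For every $\phi\in\check{\mathcal{F}}$, $$\check{\mathcal{E}}(\phi,\phi)=\frac12\int_D\int_D(\phi(x)-\phi(y))^2\big(k(x,y)+\widehat k(x,y)\big)\,dy\,dx ,$$ where $\widehat k(x,y):=\int_{D^c}\frac{k(x,z)k(z,y)}{\mu(z)}\,dz$ for $x,y\in D$.
   Context: Setting. Let $d\ge 2$ and let $j:(0,\infty)\to(0,\infty)$ be non-increasing with $\int_{\mathbb{R}^d}(1\wedge|x|^2)\,j(|x|)\,dx<\infty$. Put $k(x,y):=j(|x-y|)$. Let $D\subset\mathbb{R}^d$ be a bounded open set whose boundary $\partial D$ has Lebesgue measure zero; $D^c=\mathbb{R}^d\setminus D$, $\overline D^c=\mathbb{R}^d\setminus\overline D$. For $x\in D^c$ let $\mu(x):=\int_Dk(x,y)\,dy$ (finite on $\overline D^c$) and let $m(dx):=\mathbf{1}_D(x)\,dx+\mathbf{1}_{D^c}(x)\mu(x)\,dx$. For $u,v:\mathbb{R}^d\to\mathbb{R}$ let $$\widehat{\mathcal{E}}(u,v):=\frac12\iint_{(\mathbb{R}^d\times\mathbb{R}^d)\setminus(D^c\times D^c)}(u(x)-u(y))(v(x)-v(y))k(x,y)\,dy\,dx ,$$ and $\mathcal{F}:=\{u\in L^2(\mathbb{R}^d,m(dx)):\widehat{\mathcal{E}}(u,u)<\infty\}$, a Dirichlet form on $L^2(\mathbb{R}^d,m(dx))$. Let $\mathcal{F}_e$ be its extended Dirichlet space, i.e. the set of $m$-a.e. finite measurable $u$ for which there is an $\widehat{\mathcal{E}}$-Cauchy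 sequence $(u_n)\subset\mathcal{F}$ with $u_n\to u$ $m$-a.e. For a function $u$ set $Hu(x):=u(x)$ for $x\in D$, $Hu(x):=\int_D\frac{k(x,y)}{\mu(x)}u(y)\,dy$ for $x\in\overline D^c$, and $Hu(x):=0$ for $x\in\partial D$. Define $$\check{\mathcal{F}}:=\{\phi\in L^2(D,dx):\ \phi=u\text{ a.e. on }D\text{ for some }u\in\mathcal{F}_e\},$$ $$\check{\mathcal{E}}(\phi,\phi):=\widehat{\mathcal{E}}(Hu,Hu),\qquad\phi\in\check{\mathcal{F}},\ \phi=u\text{ a.e. on }D,\ u\in\mathcal{F}_e .$$ ($(\check{\mathcal{E}},\check{\mathcal{F}})$ is the Dirichlet form of the process $Z$ on $D$ obtained from the Markov process $Y$ associated with $(\widehat{\mathcal{E}},\mathcal{F})$ by deleting the time $Y$ spends in $\overline D^c$, that is, $Z_t=Y_{\tau_t}$ with $\tau_t=\inf\{s>0:\int_0^s\mathbf{1}_{\{Y_r\in D\}}\,dr>t\}$.) *)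

theory Defs
  imports "HOL-Analysis.Analysis"
begin

definition kern :: "(real \<Rightarrow> real) \<Rightarrow> real ^ 'n \<Rightarrow> real ^ 'n \<Rightarrow> real"
  where "kern j x y = j (norm (x - y))"

text \<open>Extended-valued, since the integral may diverge at boundary points of \<open>D\<close>.\<close>

definition mu :: "(real \<Rightarrow> real) \<Rightarrow> (real ^ 'n) set \<Rightarrow> real ^ 'n \<Rightarrow> ennreal"
  where "mu j D x = (\<integral>\<^sup>+y\<in>D. ennreal (kern j x y) \<partial>lborel)"

definition ref_measure :: "(real \<Rightarrow> real) \<Rightarrow> (real ^ 'n) set \<Rightarrow> (real ^ 'n) measure"
  where "ref_measure j D = density lborel (\<lambda>x. indicator D x + indicator (- D) x * mu j D x)"

definition E_integrand ::
    "(real \<Rightarrow> real) \<Rightarrow> (real ^ 'n \<Rightarrow> real) \<Rightarrow> (real ^ 'n \<Rightarrow> real) \<Rightarrow> (real ^ 'n) \<times> (real ^ 'n) \<Rightarrow> real"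
  where "E_integrand j u v = (\<lambda>(x, y). (u x - u y) * (v x - v y) * kern j x y)"

definition E_hat ::
    "(real \<Rightarrow> real) \<Rightarrow> (real ^ 'n) set \<Rightarrow> (real ^ 'n \<Rightarrow> real) \<Rightarrow> (real ^ 'n \<Rightarrow> real) \<Rightarrow> real"
  where "E_hat j D u v =
    1 / 2 * (LINT p : - ((- D) \<times> (- D)) | lborel \<Otimes>\<^sub>M lborel. E_integrand j u v p)"

text \<open>\<open>E_hat j D u u\<close> is the integral of a nonnegative function; its finiteness is expressed by
  integrability, because the Bochner integral of a non-integrable function is 0.\<close>

definition form_dom :: "(real \<Rightarrow> real) \<Rightarrow> (real ^ 'n) set \<Rightarrow> (real ^ 'n \<Rightarrow> real) set"
  where "form_dom j D =
    {u. u \<in> borel_measurable (ref_measure j D) \<and>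
        integrable (ref_measure j D) (\<lambda>x. (u x)\<^sup>2) \<and>
        set_integrable (lborel \<Otimes>\<^sub>M lborel) (- ((- D) \<times> (- D))) (E_integrand j u u)}"

definition ext_dom :: "(real \<Rightarrow> real) \<Rightarrow> (real ^ 'n) set \<Rightarrow> (real ^ 'n \<Rightarrow> real) set"
  where "ext_dom j D =
    {u. u \<in> borel_measurable (ref_measure j D) \<and>
        (\<exists>w :: nat \<Rightarrow> real ^ 'n \<Rightarrow> real.
           (\<forall>n. w n \<in> form_dom j D) \<and>
           (\<forall>e>0. \<exists>N. \<forall>n\<ge>N. \<forall>m\<ge>N.
              E_hat j D (\<lambda>x. w n x - w m x) (\<lambda>x. w n x - w m x) < e) \<and>
           (AE x in ref_measure j D. (\<lambda>n. w n x) \<longlonglongrightarrow> u x))}"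

definition H_ext ::
    "(real \<Rightarrow> real) \<Rightarrow> (real ^ 'n) set \<Rightarrow> (real ^ 'n \<Rightarrow> real) \<Rightarrow> real ^ 'n \<Rightarrow> real"
  where "H_ext j D u x =
    (if x \<in> D then u x
     else if x \<in> frontier D then 0
     else (LINT y : D | lborel. kern j x y / enn2real (mu j D x) * u y))"

text \<open>Elements of \<open>L\<^sup>2(D)\<close> are represented by functions on the whole space; their values outside
  \<open>D\<close> are irrelevant.\<close>

definition check_dom :: "(real \<Rightarrow> real) \<Rightarrow> (real ^ 'n) set \<Rightarrow> (real ^ 'n \<Rightarrow> real) set"
  where "check_dom j D =
    {\<phi>. \<phi> \<in> borel_measurable (restrict_space lborel D) \<and>
        integrable (restrict_space lborel D) (\<lambda>x. (\<phi> x)\<^sup>2) \<and>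
        (\<exists>u \<in> ext_dom j D. AE x in restrict_space lborel D. \<phi> x = u x)}"

text \<open>The diagonal value at \<open>\<phi>\<close>. The definite description is meaningful only if the value does
  not depend on the representative \<open>u\<close>.\<close>

definition E_check :: "(real \<Rightarrow> real) \<Rightarrow> (real ^ 'n) set \<Rightarrow> (real ^ 'n \<Rightarrow> real) \<Rightarrow> real"
  where "E_check j D \<phi> =
    (THE c. \<exists>u \<in> ext_dom j D. (AE x in restrict_space lborel D. \<phi> x = u x) \<and>
                            c = E_hat j D (H_ext j D u) (H_ext j D u))"

definition k_hat :: "(real \<Rightarrow> real) \<Rightarrow> (real ^ 'n) set \<Rightarrow> real ^ 'n \<Rightarrow> real ^ 'n \<Rightarrow> ennreal"
  where "k_hat j D x y =
    (\<integral>\<^sup>+z\<in>- D. (ennreal (kern j x z * kern j z y) / mu j D z) \<partial>lborel)"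

end

theory Submission
  imports Defs
begin

text \<open>
  For a point \<open>z\<close> outside the closure of \<open>D\<close>, the value of \<open>Hu\<close> at \<open>z\<close> is the mean of \<open>u\<close> under the
  probability measure with density \<open>k(z,\<cdot>)/\<mu>(z)\<close> on \<open>D\<close>; since \<open>k(z,\<cdot>)\<close> is bounded on \<open>D\<close>, the function
  \<open>u\<close> is square integrable under it. Twice the variance of \<open>u\<close> is the double integral of
  \<open>(u(x) - u(y))\<^sup>2\<close>, and multiplying by \<open>\<mu>(z)\<close> and integrating over \<open>z\<close> turns the cross terms of the
  energy of \<open>Hu\<close> between \<open>D\<close> and its complement into the \<open>k_hat\<close> part. Because the mean minimizes the
  quadratic deviation, the energy of \<open>Hu\<close> is at most that of \<open>u\<close>, which is finite for \<open>u\<close> in the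
  extended domain by Fatou's lemma.
\<close>

section \<open>Mean and variance under a finite measure\<close>

lemma nn_integral_square_diff_const:
  fixes f :: "'a \<Rightarrow> real"
  assumes "finite_measure M" and [measurable]: "f \<in> borel_measurable M"
    and sq: "integrable M (\<lambda>x. (f x)\<^sup>2)"
  shows "(\<integral>\<^sup>+x. ennreal ((f x - c)\<^sup>2) \<partial>M) =
    ennreal ((\<integral>x. (f x)\<^sup>2 \<partial>M) - 2 * c * (\<integral>x. f x \<partial>M) + c\<^sup>2 * measure M (space M))"
proof -
  interpret finite_measure M by fact
  have f: "integrable M f"
    using square_integrable_imp_integrable[OF _ sq] by simp
  have eq: "(f x - c)\<^sup>2 = (f x)\<^sup>2 - 2 * c * f x + c\<^sup>2" for x
    by (simp add: power2_eq_square algebra_simps)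
  have "integrable M (\<lambda>x. (f x - c)\<^sup>2)"
    unfolding eq using f sq by simp
  then have "(\<integral>\<^sup>+x. ennreal ((f x - c)\<^sup>2) \<partial>M) = ennreal (\<integral>x. (f x - c)\<^sup>2 \<partial>M)"
    by (simp add: nn_integral_eq_integral)
  also have "(\<integral>x. (f x - c)\<^sup>2 \<partial>M) =
      (\<integral>x. (f x)\<^sup>2 \<partial>M) - 2 * c * (\<integral>x. f x \<partial>M) + c\<^sup>2 * measure M (space M)"
    unfolding eq using f sq by simp
  finally show ?thesis .
qed

text \<open>Completing the square: the two sides differ by \<open>m * (h - c)\<^sup>2\<close>, where
  \<open>m\<close> is the total mass.\<close>

lemma mean_minimizes_square_deviation:
  fixes f :: "'a \<Rightarrow> real"
  assumes "finite_measure M" and "f \<in> borel_measurable M"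
    and "integrable M (\<lambda>x. (f x)\<^sup>2)" and pos: "measure M (space M) > 0"
  defines "h \<equiv> (\<integral>x. f x \<partial>M) / measure M (space M)"
  shows "(\<integral>\<^sup>+x. ennreal ((f x - h)\<^sup>2) \<partial>M) \<le> (\<integral>\<^sup>+x. ennreal ((f x - c)\<^sup>2) \<partial>M)"
proof -
  define m where "m = measure M (space M)"
  define I where "I = (\<integral>x. f x \<partial>M)"
  have I: "I = h * m"
    using pos by (simp add: h_def I_def m_def)
  have "0 \<le> m * (h - c)\<^sup>2"
    using pos by (simp add: m_def)
  then have "- 2 * h * I + h\<^sup>2 * m \<le> - 2 * c * I + c\<^sup>2 * m"
    unfolding I by (simp add: power2_eq_square algebra_simps)
  then show ?thesis
    unfolding nn_integral_square_diff_const[OF assms(1-3)] I_def m_def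
    by (intro ennreal_leI) simp
qed

text \<open>Integrating the expanded square in both variables gives
  \<open>2 * (S * m - I\<^sup>2)\<close>, and the deviation from the mean is
  \<open>S - I\<^sup>2 / m\<close>. The measure is not normalized, hence the factor of total
  mass.\<close>

lemma nn_integral_square_diff_pair:
  fixes f :: "'a \<Rightarrow> real"
  assumes "finite_measure M" and [measurable]: "f \<in> borel_measurable M"
    and sq: "integrable M (\<lambda>x. (f x)\<^sup>2)" and pos: "measure M (space M) > 0"
  defines "h \<equiv> (\<integral>x. f x \<partial>M) / measure M (space M)"
  shows "(\<integral>\<^sup>+x. \<integral>\<^sup>+y. ennreal ((f x - f y)\<^sup>2) \<partial>M \<partial>M) =
    2 * emeasure M (space M) * (\<integral>\<^sup>+x. ennreal ((f x - h)\<^sup>2) \<partial>M)"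
proof -
  interpret finite_measure M by fact
  have f: "integrable M f"
    using square_integrable_imp_integrable[OF _ sq] by simp
  define m where "m = measure M (space M)"
  define I where "I = (\<integral>x. f x \<partial>M)"
  define S where "S = (\<integral>x. (f x)\<^sup>2 \<partial>M)"
  have I: "I = h * m" and m: "m > 0"
    using pos by (simp_all add: h_def I_def m_def)
  have q: "(\<integral>\<^sup>+x. ennreal ((f x - c)\<^sup>2) \<partial>M) = ennreal (S - 2 * c * I + c\<^sup>2 * m)" for c
    unfolding S_def I_def m_def by (rule nn_integral_square_diff_const[OF assms(1-3)])
  \<comment> \<open>\<open>q\<close> does not yield this, because \<open>ennreal\<close> sends
    negative reals to 0. It is needed to return to Bochner integrals and to split a product under
    \<open>ennreal\<close>.\<close>
  have nonneg: "0 \<le> S - 2 * c * I + c\<^sup>2 * m" for c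
  proof -
    have "0 \<le> (\<integral>x. (f x - c)\<^sup>2 \<partial>M)"
      by simp
    also have "\<dots> = (\<integral>x. (f x)\<^sup>2 - 2 * c * f x + c\<^sup>2 \<partial>M)"
      by (simp add: power2_eq_square algebra_simps)
    also have "\<dots> = S - 2 * c * I + c\<^sup>2 * m"
      using f sq by (simp add: S_def I_def m_def)
    finally show ?thesis .
  qed
  have "(\<integral>\<^sup>+x. \<integral>\<^sup>+y. ennreal ((f x - f y)\<^sup>2) \<partial>M \<partial>M) =
      (\<integral>\<^sup>+x. ennreal (S - 2 * f x * I + (f x)\<^sup>2 * m) \<partial>M)"
    \<comment> \<open>For fixed \<open>x\<close> the value \<open>f x\<close> plays the role of the
      constant \<open>c\<close> in \<open>q\<close>.\<close>
    by (subst power2_commute, subst q) simp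
  also have "\<dots> = ennreal (\<integral>x. S - 2 * f x * I + (f x)\<^sup>2 * m \<partial>M)"
    using f sq nonneg by (intro nn_integral_eq_integral) auto
  also have "(\<integral>x. S - 2 * f x * I + (f x)\<^sup>2 * m \<partial>M) = S * m - 2 * I * I + S * m"
    using f sq by (simp add: S_def I_def m_def mult.commute)
  also have "\<dots> = 2 * m * (S - 2 * h * I + h\<^sup>2 * m)"
    unfolding I by (simp add: power2_eq_square algebra_simps)
  also have "ennreal \<dots> = 2 * ennreal m * ennreal (S - 2 * h * I + h\<^sup>2 * m)"
    using m nonneg[of h] by (simp add: ennreal_mult)
  finally show ?thesis
    by (simp add: q emeasure_eq_measure m_def)
qed

section \<open>The kernel and the extended-valued energy\<close>

lemma kern_commute: "kern j x y = kern j y x"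
  by (simp add: kern_def norm_minus_commute)

text \<open>A monotone function on \<open>{0<..}\<close> is Borel there. The value
  \<open>j 0\<close> on the diagonal is arbitrary and becomes a case of its own.\<close>

lemma borel_measurable_kern:
  fixes j :: "real \<Rightarrow> real"
  assumes "antimono_on {0<..} j"
  shows "(\<lambda>p. kern j (fst p) (snd p :: real ^ 'n)) \<in> borel_measurable (borel \<Otimes>\<^sub>M borel)"
proof -
  have "mono_on {0<..} (\<lambda>r. - j r)"
    using assms by (auto simp: monotone_on_def)
  then have "(\<lambda>r. - j r) \<in> borel_measurable (restrict_space borel {0<..})"
    by (rule borel_measurable_mono_on_fnc)
  then have "(\<lambda>r. - (- j r)) \<in> borel_measurable (restrict_space borel {0<..})"
    by (rule borel_measurable_uminus)
  then have [measurable]: "(\<lambda>r. indicator {0<..} r *\<^sub>R j r) \<in> borel_measurable borel"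
    by (subst (asm) borel_measurable_restrict_space_iff) auto
  have "(\<lambda>p :: (real ^ 'n) \<times> (real ^ 'n). if fst p - snd p = 0 then j 0
      else (\<lambda>r. indicator {0<..} r *\<^sub>R j r) (norm (fst p - snd p)))
    \<in> borel_measurable (borel \<Otimes>\<^sub>M borel)"
    by measurable
  then show ?thesis
    by (rule measurable_cong[THEN iffD1, rotated]) (auto simp: kern_def)
qed

text \<open>With \<open>kern\<close> as a separate \<open>ennreal\<close> factor it can act as a
  density. On the diagonal the first factor vanishes, so the sign of \<open>j 0\<close> does no
  harm.\<close>

definition energy_density ::
    "(real \<Rightarrow> real) \<Rightarrow> (real ^ 'n \<Rightarrow> real) \<Rightarrow> real ^ 'n \<Rightarrow> real ^ 'n \<Rightarrow> ennreal"
  where "energy_density j v x y = ennreal ((v x - v y)\<^sup>2) * ennreal (kern j x y)"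

text \<open>Twice the form, as an extended integral: no junk value when it diverges.\<close>

definition energy :: "(real \<Rightarrow> real) \<Rightarrow> (real ^ 'n) set \<Rightarrow> (real ^ 'n \<Rightarrow> real) \<Rightarrow> ennreal"
  where "energy j D v =
    (\<integral>\<^sup>+p\<in>- ((- D) \<times> (- D)). energy_density j v (fst p) (snd p) \<partial>(lborel \<Otimes>\<^sub>M lborel))"

lemma energy_density_commute: "energy_density j v x y = energy_density j v y x"
  by (simp add: energy_density_def kern_commute power2_commute)

locale radial_kernel =
  fixes j :: "real \<Rightarrow> real" and D :: "(real ^ 'n) set"
  assumes j_pos: "\<And>r. r > 0 \<Longrightarrow> j r > 0"
    and j_antimono: "antimono_on {0<..} j"
    and bounded_D: "bounded D" and open_D: "open D"
    and null_frontier: "frontier D \<in> null_sets lborel"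
begin

section \<open>Measurability, positivity and finiteness of the weight \<open>mu\<close>\<close>

lemma D_borel [measurable]: "D \<in> sets borel"
  using open_D by simp

lemma kern_pair_measurable [measurable]:
  "(\<lambda>p. kern j (fst p) (snd p :: real ^ 'n)) \<in> borel_measurable (borel \<Otimes>\<^sub>M borel)"
  by (rule borel_measurable_kern[OF j_antimono])

lemma kern_measurable [measurable (raw)]:
  fixes f g :: "'a \<Rightarrow> real ^ 'n"
  assumes [measurable]: "f \<in> borel_measurable M" "g \<in> borel_measurable M"
  shows "(\<lambda>x. kern j (f x) (g x)) \<in> borel_measurable M"
proof -
  have "(\<lambda>x. (f x, g x)) \<in> measurable M (borel \<Otimes>\<^sub>M borel)"
    by measurable
  from measurable_compose[OF this kern_pair_measurable] show ?thesis
    by simp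
qed

lemma kern_pos: "x \<noteq> y \<Longrightarrow> kern j x y > 0"
  by (simp add: kern_def j_pos)

lemma energy_density_measurable [measurable (raw)]:
  fixes f g :: "'a \<Rightarrow> real ^ 'n"
  assumes [measurable]: "v \<in> borel_measurable borel"
    "f \<in> borel_measurable M" "g \<in> borel_measurable M"
  shows "(\<lambda>x. energy_density j v (f x) (g x)) \<in> borel_measurable M"
  unfolding energy_density_def by measurable

lemma mu_measurable [measurable]: "mu j D \<in> borel_measurable borel"
  unfolding mu_def[abs_def] by measurable

text \<open>If the integral vanished, positivity of the kernel off the diagonal would make
  \<open>D\<close> a null set, which a nonempty open set is not.\<close>

lemma mu_pos:
  assumes "D \<noteq> {}"
  shows "mu j D x > 0"
proof (rule ccontr)
  assume "\<not> mu j D x > 0"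
  then have "(\<integral>\<^sup>+y\<in>D. ennreal (kern j x y) \<partial>lborel) = 0"
    by (simp add: mu_def)
  then have "AE y in lborel. ennreal (kern j x y) * indicator D y = 0"
    by (subst (asm) nn_integral_0_iff_AE) auto
  moreover have "AE y in lborel. y \<noteq> x"
    by (rule AE_lborel_singleton)
  ultimately have "AE y in lborel. y \<notin> D"
  proof eventually_elim
    case (elim y)
    then show ?case
      using kern_pos[of x y] by (auto simp: indicator_def split: if_splits)
  qed
  then have "D \<in> null_sets lborel"
    by (simp add: AE_iff_null_sets)
  then show False
    using open_not_negligible[OF open_D assms] null_sets_completionI
    by (auto simp: negligible_iff_null_sets)
qed

text \<open>Some ball of radius \<open>e\<close> around \<open>z\<close> misses \<open>D\<close>, so
  monotonicity gives the bound \<open>j e\<close>. This yields both finiteness of \<open>mu\<close>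
  and square integrability under the kernel.\<close>

lemma kern_bounded:
  assumes "z \<notin> closure D"
  obtains B where "B \<ge> 0" "\<And>y. y \<in> D \<Longrightarrow> kern j z y \<le> B"
proof -
  obtain e where e: "e > 0" "ball z e \<subseteq> - closure D"
    using assms open_contains_ball[of "- closure D"] by auto
  show thesis
  proof
    show "j e \<ge> 0"
      using j_pos[OF e(1)] by simp
    fix y assume "y \<in> D"
    then have "y \<notin> ball z e"
      using e(2) closure_subset[of D] by blast
    then have "e \<le> norm (z - y)"
      by (simp add: dist_norm)
    then show "kern j z y \<le> j e"
      using e(1) monotone_onD[OF j_antimono, of e "norm (z - y)"] unfolding kern_def by fastforce
  qed
qed

lemma emeasure_D: "emeasure lborel D < \<infinity>"
  using bounded_D by (rule emeasure_bounded_finite)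

lemma mu_finite:
  assumes "z \<notin> closure D"
  shows "mu j D z < \<infinity>"
proof -
  obtain B where B: "B \<ge> 0" "\<And>y. y \<in> D \<Longrightarrow> kern j z y \<le> B"
    using kern_bounded[OF assms] by blast
  have "mu j D z \<le> (\<integral>\<^sup>+y. ennreal B * indicator D y \<partial>lborel)"
    unfolding mu_def using B by (intro nn_integral_mono) (auto simp: indicator_def ennreal_leI)
  also have "\<dots> < \<infinity>"
    using emeasure_D by (simp add: nn_integral_cmult ennreal_mult_less_top)
  finally show ?thesis .
qed

section \<open>Comparison of \<open>energy\<close> with \<open>E_hat\<close>, and its
  decomposition\<close>

lemma H_ext_on_D: "x \<in> D \<Longrightarrow> H_ext j D u x = u x"
  by (simp add: H_ext_def)

lemma AE_notin_frontier: "AE z in lborel. z \<notin> frontier D"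
  using null_frontier by (rule AE_not_in)

text \<open>Off the diagonal \<open>kern\<close> is positive; on it everything vanishes, whatever
  \<open>j 0\<close> is.\<close>

lemma E_integrand_eq: "ennreal (E_integrand j v v p) = energy_density j v (fst p) (snd p)"
  "E_integrand j v v p \<ge> 0"
proof -
  obtain x y where p: "p = (x, y)"
    by (cases p)
  show "ennreal (E_integrand j v v p) = energy_density j v (fst p) (snd p)"
    "E_integrand j v v p \<ge> 0"
    using kern_pos[of x y]
    by (cases "x = y"; simp add: p E_integrand_def energy_density_def ennreal_mult' power2_eq_square)+
qed

lemma E_integrand_measurable [measurable]:
  fixes v :: "real ^ 'n \<Rightarrow> real"
  assumes [measurable]: "v \<in> borel_measurable borel"
  shows "E_integrand j v v \<in> borel_measurable (lborel \<Otimes>\<^sub>M lborel)"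
  unfolding E_integrand_def case_prod_unfold by measurable

lemma off_exterior_measurable [measurable]:
  "- ((- D) \<times> (- D)) \<in> sets (lborel \<Otimes>\<^sub>M lborel)"
proof -
  have "- ((- D) \<times> (- D)) = D \<times> UNIV \<union> UNIV \<times> D"
    by auto
  also have "\<dots> \<in> sets (lborel \<Otimes>\<^sub>M lborel)"
    by (intro sets.Un pair_measureI) auto
  finally show ?thesis .
qed

lemma energy_eq:
  "energy j D v = (\<integral>\<^sup>+p. ennreal (indicator (- ((- D) \<times> (- D))) p *\<^sub>R E_integrand j v v p) \<partial>(lborel \<Otimes>\<^sub>M lborel))"
  unfolding energy_def E_integrand_eq(1)[symmetric]
  by (intro nn_integral_cong) (auto simp: indicator_def)

text \<open>Translates the integrability condition of \<open>form_dom\<close> into finite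
  \<open>energy\<close>; the integrand is nonnegative.\<close>

lemma set_integrable_E_integrand_iff:
  assumes [measurable]: "v \<in> borel_measurable borel"
  shows "set_integrable (lborel \<Otimes>\<^sub>M lborel) (- ((- D) \<times> (- D))) (E_integrand j v v) \<longleftrightarrow>
    energy j D v < \<infinity>"
  unfolding set_integrable_def energy_eq
  by (subst integrable_iff_bounded) (simp add: E_integrand_eq(2))

text \<open>The factor 2 undoes the \<open>1 / 2\<close> in \<open>E_hat\<close>; finiteness rules
  out the default value 0 of the Bochner integral.\<close>

lemma energy_eq_E_hat:
  assumes v: "v \<in> borel_measurable borel" and fin: "energy j D v < \<infinity>"
  shows "energy j D v = ennreal (2 * E_hat j D v v)" "E_hat j D v v \<ge> 0"
proof -
  show "energy j D v = ennreal (2 * E_hat j D v v)"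
    using set_integrable_E_integrand_iff[OF v] fin
    unfolding energy_eq E_hat_def set_integrable_def set_lebesgue_integral_def
    by (subst nn_integral_eq_integral) (auto simp: E_integrand_eq(2))
  show "E_hat j D v v \<ge> 0"
    unfolding E_hat_def set_lebesgue_integral_def
    by (auto simp: E_integrand_eq(2) intro!: integral_nonneg_AE)
qed

text \<open>The domain of integration consists of \<open>D \<times> D\<close> and two mixed
  products, which contribute equally by symmetry of the density.\<close>

lemma energy_split:
  assumes [measurable]: "v \<in> borel_measurable borel"
  shows "energy j D v =
    (\<integral>\<^sup>+x\<in>D. (\<integral>\<^sup>+y\<in>D. energy_density j v x y \<partial>lborel) \<partial>lborel) +
    2 * (\<integral>\<^sup>+z\<in>- D. (\<integral>\<^sup>+x\<in>D. energy_density j v z x \<partial>lborel) \<partial>lborel)"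
proof -
  let ?e = "energy_density j v"
  let ?A = "\<lambda>x y. ?e x y * indicator D y * indicator D x"
  let ?B = "\<lambda>x y. ?e x y * indicator D y * indicator (- D) x"
  have "energy j D v = (\<integral>\<^sup>+x. \<integral>\<^sup>+y. ?e x y * indicator (- ((- D) \<times> (- D))) (x, y) \<partial>lborel \<partial>lborel)"
    unfolding energy_def by (subst lborel.nn_integral_fst[symmetric]) auto
  also have "\<dots> = (\<integral>\<^sup>+x. \<integral>\<^sup>+y. (?A x y + ?B x y) + ?B y x \<partial>lborel \<partial>lborel)"
    by (intro nn_integral_cong) (auto simp: indicator_def energy_density_commute)
  also have "\<dots> = (\<integral>\<^sup>+x. \<integral>\<^sup>+y. ?A x y \<partial>lborel \<partial>lborel) + (\<integral>\<^sup>+x. \<integral>\<^sup>+y. ?B x y \<partial>lborel \<partial>lborel) +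
      (\<integral>\<^sup>+x. \<integral>\<^sup>+y. ?B y x \<partial>lborel \<partial>lborel)"
    by (simp add: nn_integral_add)
  also have "(\<integral>\<^sup>+x. \<integral>\<^sup>+y. ?B y x \<partial>lborel \<partial>lborel) = (\<integral>\<^sup>+x. \<integral>\<^sup>+y. ?B x y \<partial>lborel \<partial>lborel)"
    by (rule lborel_pair.Fubini') measurable
  finally show ?thesis
    by (simp add: nn_integral_multc mult_2 add.assoc)
qed

text \<open>From \<open>(a - b)\<^sup>2 \<le> 2 * a\<^sup>2 + 2 * b\<^sup>2\<close>; it replaces the
  triangle inequality and also allows infinite energies.\<close>

lemma energy_diff_le:
  assumes [measurable]: "v \<in> borel_measurable borel" "w \<in> borel_measurable borel"
  shows "energy j D (\<lambda>x. v x - w x) \<le> 2 * energy j D v + 2 * energy j D w"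
proof -
  have le: "energy_density j (\<lambda>x. v x - w x) x y \<le>
      2 * energy_density j v x y + 2 * energy_density j w x y" for x y
  proof -
    have "((v x - w x) - (v y - w y))\<^sup>2 \<le> 2 * (v x - v y)\<^sup>2 + 2 * (w x - w y)\<^sup>2"
      using zero_le_power2[of "(v x - v y) + (w x - w y)"]
      by (simp add: power2_eq_square algebra_simps)
    then have "ennreal (((v x - w x) - (v y - w y))\<^sup>2) \<le>
        2 * ennreal ((v x - v y)\<^sup>2) + 2 * ennreal ((w x - w y)\<^sup>2)"
      by (subst (asm) ennreal_le_iff[symmetric]) (auto simp: ennreal_mult)
    from mult_right_mono[OF this, of "ennreal (kern j x y)"] show ?thesis
      by (simp add: energy_density_def algebra_simps)
  qed
  let ?S = "- ((- D) \<times> (- D))"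
  have "energy j D (\<lambda>x. v x - w x) \<le> (\<integral>\<^sup>+p. 2 * (energy_density j v (fst p) (snd p) * indicator ?S p)
      + 2 * (energy_density j w (fst p) (snd p) * indicator ?S p) \<partial>(lborel \<Otimes>\<^sub>M lborel))"
    unfolding energy_def using le by (intro nn_integral_mono) (auto simp: indicator_def)
  also have "\<dots> = 2 * energy j D v + 2 * energy j D w"
    unfolding energy_def by (subst nn_integral_add) (simp_all add: nn_integral_cmult)
  finally show ?thesis .
qed

section \<open>Finite energy on the extended domain\<close>

lemma ext_dom_measurable: "u \<in> ext_dom j D \<Longrightarrow> u \<in> borel_measurable borel"
  by (simp add: ext_dom_def ref_measure_def)

lemma form_domD:
  assumes "w \<in> form_dom j D"
  shows "w \<in> borel_measurable borel" "energy j D w < \<infinity>"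
proof -
  show w: "w \<in> borel_measurable borel"
    using assms by (simp add: form_dom_def ref_measure_def)
  show "energy j D w < \<infinity>"
    using assms set_integrable_E_integrand_iff[OF w] by (simp add: form_dom_def)
qed

text \<open>The density of \<open>ref_measure\<close> is 1 on \<open>D\<close> and \<open>mu\<close>
  elsewhere, hence positive everywhere, so its null sets are Lebesgue null.\<close>

lemma AE_ref_measureD:
  assumes "AE x in ref_measure j D. P x" and "D \<noteq> {}"
  shows "AE x in lborel. P x"
proof -
  have "AE x in lborel. 0 < indicator D x + indicator (- D) x * mu j D x \<longrightarrow> P x"
    using assms(1) unfolding ref_measure_def by (subst (asm) AE_density) auto
  then show ?thesis
  proof eventually_elim
    case (elim x)
    then show ?case
      using mu_pos[OF assms(2), of x] by (auto simp: indicator_def split: if_splits)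
  qed
qed

text \<open>The Cauchy property bounds the energies of the approximating sequence, and Fatou's lemma
  passes the bound to the limit.\<close>

lemma energy_ext_dom_finite:
  assumes u: "u \<in> ext_dom j D" and ne: "D \<noteq> {}"
  shows "energy j D u < \<infinity>"
proof -
  obtain w where w: "\<And>n. w n \<in> form_dom j D"
    and cauchy: "\<And>e. e > 0 \<Longrightarrow> \<exists>N. \<forall>n\<ge>N. \<forall>m\<ge>N.
              E_hat j D (\<lambda>x. w n x - w m x) (\<lambda>x. w n x - w m x) < e"
    and ref_lim: "AE x in ref_measure j D. (\<lambda>n. w n x) \<longlonglongrightarrow> u x"
    using u unfolding ext_dom_def by blast
  note [measurable] = ext_dom_measurable[OF u] form_domD(1)[OF w]
  have fin: "energy j D (w n) < \<infinity>" for n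
    using form_domD(2)[OF w] .
  have lim: "AE x in lborel. (\<lambda>n. w n x) \<longlonglongrightarrow> u x"
    using AE_ref_measureD[OF ref_lim ne] .
  \<comment> \<open>Without this, \<open>E_hat\<close> of a difference might be small only because a
    divergent integral has value 0.\<close>
  have fin_diff: "energy j D (\<lambda>x. w n x - w m x) < \<infinity>" for n m
  proof -
    have "energy j D (\<lambda>x. w n x - w m x) \<le> 2 * energy j D (w n) + 2 * energy j D (w m)"
      by (rule energy_diff_le) auto
    also have "\<dots> < \<infinity>"
      using fin by (simp add: ennreal_mult_less_top)
    finally show ?thesis .
  qed
  obtain N where N: "\<And>n. n \<ge> N \<Longrightarrow> E_hat j D (\<lambda>x. w n x - w N x) (\<lambda>x. w n x - w N x) < 1"
    using cauchy[of 1] by auto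
  \<comment> \<open>From \<open>N\<close> on, \<open>E_hat\<close> of the difference is below 1, so
    its \<open>energy\<close> is at most 2; both coefficients 2 in front come from
    \<open>energy_diff_le\<close>.\<close>
  define C where "C = 2 * 2 + 2 * energy j D (w N)"
  have bound: "energy j D (w n) \<le> C" if "n \<ge> N" for n
  proof -
    \<comment> \<open>The sum of \<open>w n - w N\<close> and \<open>w N\<close> is written as a
      difference to fit \<open>energy_diff_le\<close>.\<close>
    have eq: "energy j D (w n) = energy j D (\<lambda>x. (w n x - w N x) - (- w N x))"
      by simp
    have uminus: "energy j D (\<lambda>x. - w N x) = energy j D (w N)"
      by (simp add: energy_def energy_density_def power2_commute)
    have "energy j D (w n) \<le> 2 * energy j D (\<lambda>x. w n x - w N x) + 2 * energy j D (\<lambda>x. - w N x)"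
      unfolding eq by (rule energy_diff_le) auto
    also have "energy j D (\<lambda>x. w n x - w N x) \<le> 2"
    proof -
      have "energy j D (\<lambda>x. w n x - w N x) =
          ennreal (2 * E_hat j D (\<lambda>x. w n x - w N x) (\<lambda>x. w n x - w N x))"
        by (rule energy_eq_E_hat(1)) (use fin_diff in auto)
      also have "\<dots> \<le> ennreal 2"
        using N[OF that] by (intro ennreal_leI) simp
      finally show ?thesis
        by simp
    qed
    finally show ?thesis
      unfolding uminus C_def by (simp add: add_mono mult_left_mono)
  qed
  let ?S = "- ((- D) \<times> (- D))"
  let ?f = "\<lambda>v p. energy_density j v (fst p) (snd p) * indicator ?S p"
  have "AE p in lborel \<Otimes>\<^sub>M lborel. ?f u p = liminf (\<lambda>n. ?f (w n) p)"
  proof -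
    have lim_pair: "AE p in lborel \<Otimes>\<^sub>M lborel. (\<lambda>n. w n (fst p)) \<longlonglongrightarrow> u (fst p) \<and>
        (\<lambda>n. w n (snd p)) \<longlonglongrightarrow> u (snd p)"
    proof (rule lborel_pair.AE_pair_measure)
      show "AE x in lborel. AE y in lborel. (\<lambda>n. w n (fst (x, y))) \<longlonglongrightarrow> u (fst (x, y)) \<and>
          (\<lambda>n. w n (snd (x, y))) \<longlonglongrightarrow> u (snd (x, y))"
        using lim
      proof eventually_elim
        case (elim x)
        from lim show ?case
          by eventually_elim (use elim in simp)
      qed
    qed measurable
    then show ?thesis
    proof eventually_elim
      case (elim p)
      \<comment> \<open>The limit is taken in the reals, where products converge without side
        conditions, and then carried to \<open>ennreal\<close>.\<close>
      then have "(\<lambda>n. E_integrand j (w n) (w n) p) \<longlonglongrightarrow> E_integrand j u u p"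
        unfolding E_integrand_def case_prod_unfold by (intro tendsto_intros) auto
      then have "(\<lambda>n. energy_density j (w n) (fst p) (snd p)) \<longlonglongrightarrow> energy_density j u (fst p) (snd p)"
        unfolding E_integrand_eq(1)[symmetric] by (rule tendsto_ennrealI)
      then have "(\<lambda>n. ?f (w n) p) \<longlonglongrightarrow> ?f u p"
        by (auto simp: indicator_def)
      then show ?case
        by (simp add: lim_imp_Liminf)
    qed
  qed
  then have "energy j D u = (\<integral>\<^sup>+p. liminf (\<lambda>n. ?f (w n) p) \<partial>(lborel \<Otimes>\<^sub>M lborel))"
    unfolding energy_def by (rule nn_integral_cong_AE)
  also have "\<dots> \<le> liminf (\<lambda>n. energy j D (w n))"
    unfolding energy_def by (rule nn_integral_liminf) measurable
  also have "\<dots> \<le> liminf (\<lambda>n. C)"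
    using bound by (intro Liminf_mono) (auto simp: eventually_sequentially)
  also have "\<dots> = C"
    by (simp add: Liminf_const)
  also have "C < \<infinity>"
    using fin[of N] by (simp add: C_def ennreal_mult_less_top)
  finally show ?thesis .
qed

section \<open>The extension \<open>H_ext\<close> and its energy at a single exterior point\<close>

lemma H_ext_measurable [measurable]:
  assumes [measurable]: "u \<in> borel_measurable borel"
  shows "H_ext j D u \<in> borel_measurable borel"
proof -
  have "(\<lambda>x. LINT y : D | lborel. kern j x y / enn2real (mu j D x) * u y) \<in> borel_measurable borel"
    unfolding set_lebesgue_integral_def by measurable
  moreover have "frontier D \<in> sets borel"
    by simp
  ultimately show ?thesis
    unfolding H_ext_def[abs_def] by measurable
qed

context
  fixes u :: "real ^ 'n \<Rightarrow> real" and z :: "real ^ 'n"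
  assumes ne: "D \<noteq> {}" and z: "z \<notin> closure D"
    and u_meas [measurable]: "u \<in> borel_measurable borel"
    and u_sq: "integrable lborel (\<lambda>x. indicator D x * (u x)\<^sup>2)"
begin

text \<open>Left unnormalized: the total mass is \<open>mu j D z\<close>, so the mean is a quotient,
  and the weights multiply to the numerator in \<open>k_hat\<close>.\<close>

abbreviation (input) "dens \<equiv> (\<lambda>x. indicator D x * kern j z x)"

lemma z_notin: "z \<notin> D"
  using z closure_subset by blast

text \<open>As \<open>z\<close> lies outside \<open>D\<close>, the indicator removes the diagonal
  value \<open>j 0\<close>, whose sign is unknown.\<close>

lemma dens_nonneg: "dens x \<ge> 0"
  using kern_pos[of z x] z_notin by (cases "x = z") (auto simp: indicator_def)

lemma nn_integral_dens:
  assumes [measurable]: "f \<in> borel_measurable borel"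
  shows "(\<integral>\<^sup>+x. f x \<partial>density lborel dens) = (\<integral>\<^sup>+x\<in>D. (f x * ennreal (kern j z x)) \<partial>lborel)"
  by (subst nn_integral_density) (auto intro!: nn_integral_cong simp: indicator_def mult.commute)

lemma dens_mass: "emeasure (density lborel dens) (space (density lborel dens)) = mu j D z"
  using nn_integral_dens[of "\<lambda>_. 1"] by (simp add: mu_def)

lemma dens_finite: "finite_measure (density lborel dens)"
  using dens_mass mu_finite[OF z] by (intro finite_measureI) simp

lemma dens_measure: "measure (density lborel dens) (space (density lborel dens)) = enn2real (mu j D z)"
  by (simp only: measure_def dens_mass)

lemma enn2real_mu_pos: "enn2real (mu j D z) > 0"
  using mu_pos[OF ne, of z] mu_finite[OF z] by (simp add: enn2real_positive_iff)

lemma dens_measure_pos: "measure (density lborel dens) (space (density lborel dens)) > 0"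
  unfolding dens_measure by (rule enn2real_mu_pos)

text \<open>The kernel is bounded by \<open>B\<close> on \<open>D\<close>, so the integrand is
  dominated by \<open>B\<close> times that of \<open>u_sq\<close>.\<close>

lemma dens_sq: "integrable (density lborel dens) (\<lambda>x. (u x)\<^sup>2)"
proof -
  obtain B where B: "B \<ge> 0" "\<And>y. y \<in> D \<Longrightarrow> kern j z y \<le> B"
    using kern_bounded[OF z] by blast
  have "integrable lborel (\<lambda>x. dens x *\<^sub>R (u x)\<^sup>2)"
  proof (rule Bochner_Integration.integrable_bound)
    show "integrable lborel (\<lambda>x. B * (indicator D x * (u x)\<^sup>2))"
      using u_sq by simp
    show "AE x in lborel. norm (dens x *\<^sub>R (u x)\<^sup>2) \<le> norm (B * (indicator D x * (u x)\<^sup>2))"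
    proof (rule AE_I2)
      fix x
      have "dens x \<le> B * indicator D x"
        using B by (simp add: indicator_def)
      from mult_right_mono[OF this, of "(u x)\<^sup>2"]
      show "norm (dens x *\<^sub>R (u x)\<^sup>2) \<le> norm (B * (indicator D x * (u x)\<^sup>2))"
        using dens_nonneg[of x] B(1)
        by (cases "x \<in> D") simp_all
    qed
  qed measurable
  then show ?thesis
    by (subst integrable_density) (auto simp: dens_nonneg)
qed

lemma H_ext_eq_mean: "H_ext j D u z =
  (\<integral>x. u x \<partial>density lborel dens) / measure (density lborel dens) (space (density lborel dens))"
proof -
  have "(\<integral>x. u x \<partial>density lborel dens) = (\<integral>x. dens x * u x \<partial>lborel)"
    by (subst integral_density) (auto simp: dens_nonneg)
  moreover have "H_ext j D u z = (\<integral>x. dens x * u x / enn2real (mu j D z) \<partial>lborel)"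
    using z z_notin by (simp add: H_ext_def frontier_def set_lebesgue_integral_def mult_ac)
  ultimately show ?thesis
    unfolding dens_measure by simp
qed

text \<open>The value at \<open>z\<close> enters only as a constant; a general \<open>v\<close>
  covers both \<open>u\<close> and \<open>H_ext j D u\<close>.\<close>

lemma exterior_energy_eq_dens:
  assumes "v z = c" and "\<And>x. x \<in> D \<Longrightarrow> v x = u x"
  shows "(\<integral>\<^sup>+x\<in>D. energy_density j v z x \<partial>lborel) = (\<integral>\<^sup>+x. ennreal ((u x - c)\<^sup>2) \<partial>density lborel dens)"
  unfolding energy_density_def using assms
  by (subst nn_integral_dens) (auto intro!: nn_integral_cong simp: indicator_def power2_commute)

text \<open>\<open>H_ext j D u z\<close> is the mean of \<open>u\<close>, and \<open>u z\<close> is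
  merely one competing constant.\<close>

lemma exterior_energy_H_ext_le:
  "(\<integral>\<^sup>+x\<in>D. energy_density j (H_ext j D u) z x \<partial>lborel) \<le> (\<integral>\<^sup>+x\<in>D. energy_density j u z x \<partial>lborel)"
proof -
  have "(\<integral>\<^sup>+x. ennreal ((u x - H_ext j D u z)\<^sup>2) \<partial>density lborel dens) \<le>
      (\<integral>\<^sup>+x. ennreal ((u x - u z)\<^sup>2) \<partial>density lborel dens)"
    unfolding H_ext_eq_mean 
    by (intro mean_minimizes_square_deviation dens_finite dens_sq dens_measure_pos) simp
  then show ?thesis
    by (simp add: exterior_energy_eq_dens[where v = "H_ext j D u", OF refl H_ext_on_D] exterior_energy_eq_dens[where v = u, OF refl refl])
qed

text \<open>The pair form of the variance, with weights \<open>kern j z x\<close> and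
  \<open>kern j z y\<close>, divided by the mass \<open>mu j D z\<close>.\<close>

lemma exterior_energy_H_ext:
  "2 * (\<integral>\<^sup>+x\<in>D. energy_density j (H_ext j D u) z x \<partial>lborel) =
   (\<integral>\<^sup>+x\<in>D. (\<integral>\<^sup>+y\<in>D. (ennreal ((u x - u y)\<^sup>2) * (ennreal (kern j x z * kern j z y) / mu j D z)) \<partial>lborel) \<partial>lborel)"
  (is "2 * ?L = ?R")
proof -
  let ?k = "\<lambda>x. ennreal (kern j z x)"
  let ?P = "\<integral>\<^sup>+x\<in>D. ((\<integral>\<^sup>+y\<in>D. (ennreal ((u x - u y)\<^sup>2) * ?k y) \<partial>lborel) * ?k x) \<partial>lborel"
  \<comment> \<open>Cancelling \<open>mu j D z\<close> in \<open>ennreal\<close> requires it to be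
    neither 0 nor \<open>top\<close>.\<close>
  have m0: "mu j D z \<noteq> 0" and m1: "mu j D z \<noteq> top"
    using mu_pos[OF ne, of z] mu_finite[OF z] by auto
  have "?P = (\<integral>\<^sup>+x. \<integral>\<^sup>+y. ennreal ((u x - u y)\<^sup>2) \<partial>density lborel dens \<partial>density lborel dens)"
    by (simp add: nn_integral_dens)
  also have "\<dots> = 2 * mu j D z * (\<integral>\<^sup>+x. ennreal ((u x - H_ext j D u z)\<^sup>2) \<partial>density lborel dens)"
    unfolding H_ext_eq_mean dens_mass[symmetric] 
    by (intro nn_integral_square_diff_pair dens_finite dens_sq dens_measure_pos) simp
  also have "(\<integral>\<^sup>+x. ennreal ((u x - H_ext j D u z)\<^sup>2) \<partial>density lborel dens) = ?L"
    by (simp add: exterior_energy_eq_dens[where v = "H_ext j D u", OF refl H_ext_on_D])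
  finally have P: "?P = mu j D z * (2 * ?L)"
    by (simp add: mult_ac)
  have "?R = (\<integral>\<^sup>+x\<in>D. (((\<integral>\<^sup>+y\<in>D. (ennreal ((u x - u y)\<^sup>2) * ?k y) \<partial>lborel) * ?k x) / mu j D z) \<partial>lborel)"
  proof (intro nn_integral_cong)
    fix x
    \<comment> \<open>For \<open>x\<close> in \<open>D\<close> one has \<open>x \<noteq> z\<close>,
      so the first factor is positive; that suffices to split the product for every
      \<open>y\<close>.\<close>
    have k: "ennreal (kern j x z * kern j z y) = ?k x * ?k y" if "x \<in> D" for y
      using kern_pos[of z x] that z_notin kern_commute[of j x z]
      by (cases "x = z") (auto simp: ennreal_mult')
    have "(\<integral>\<^sup>+y\<in>D. (ennreal ((u x - u y)\<^sup>2) * (ennreal (kern j x z * kern j z y) / mu j D z)) \<partial>lborel)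
       = (\<integral>\<^sup>+y. (ennreal ((u x - u y)\<^sup>2) * ?k y * indicator D y) * (?k x / mu j D z) \<partial>lborel)" if "x \<in> D"
      unfolding k[OF that]
      by (intro nn_integral_cong) (simp add: divide_ennreal_def mult_ac)
    also have "\<dots> = (\<integral>\<^sup>+y\<in>D. (ennreal ((u x - u y)\<^sup>2) * ?k y) \<partial>lborel) * (?k x / mu j D z)"
      by (rule nn_integral_multc) measurable
    finally show "(\<integral>\<^sup>+y\<in>D. (ennreal ((u x - u y)\<^sup>2) * (ennreal (kern j x z * kern j z y) / mu j D z)) \<partial>lborel) * indicator D x
       = (((\<integral>\<^sup>+y\<in>D. (ennreal ((u x - u y)\<^sup>2) * ?k y) \<partial>lborel) * ?k x) / mu j D z) * indicator D x"
      by (cases "x \<in> D") (auto simp: divide_ennreal_def mult_ac)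
  qed
  also have "\<dots> = ?P / mu j D z"
    by (subst nn_integral_divide[symmetric]) (auto intro!: nn_integral_cong simp: divide_ennreal_def mult_ac)
  also have "\<dots> = 2 * ?L"
    unfolding P using m0 m1 by (simp add: ennreal_mult_divide_eq mult.commute[of "mu j D z"])
  finally show ?thesis ..
qed

end

section \<open>Integration over all exterior points\<close>

lemma closure_eq_outside_frontier:
  assumes "z \<notin> D" "z \<notin> frontier D"
  shows "z \<notin> closure D"
  using assms open_D by (simp add: frontier_def interior_open)

text \<open>The parts over \<open>D \<times> D\<close> coincide and the mixed parts compare
  pointwise in \<open>z\<close>, apart from the null boundary.\<close>

lemma energy_H_ext_le:
  assumes ne: "D \<noteq> {}" and [measurable]: "u \<in> borel_measurable borel"
    and sq: "integrable lborel (\<lambda>x. indicator D x * (u x)\<^sup>2)"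
  shows "energy j D (H_ext j D u) \<le> energy j D u"
proof -
  have "(\<integral>\<^sup>+x\<in>D. (\<integral>\<^sup>+y\<in>D. energy_density j (H_ext j D u) x y \<partial>lborel) \<partial>lborel) =
      (\<integral>\<^sup>+x\<in>D. (\<integral>\<^sup>+y\<in>D. energy_density j u x y \<partial>lborel) \<partial>lborel)"
    by (auto intro!: nn_integral_cong simp: indicator_def energy_density_def H_ext_on_D)
  moreover have "(\<integral>\<^sup>+z\<in>- D. (\<integral>\<^sup>+x\<in>D. energy_density j (H_ext j D u) z x \<partial>lborel) \<partial>lborel) \<le>
      (\<integral>\<^sup>+z\<in>- D. (\<integral>\<^sup>+x\<in>D. energy_density j u z x \<partial>lborel) \<partial>lborel)"
    using AE_notin_frontier
  proof (intro nn_integral_mono_AE, eventually_elim)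
    case (elim z)
    then show ?case
      using exterior_energy_H_ext_le[OF ne closure_eq_outside_frontier assms(2) sq]
      by (auto simp: indicator_def)
  qed
  ultimately show ?thesis
    by (simp add: energy_split add_left_mono mult_left_mono)
qed

text \<open>The factor 2 of the mixed part in \<open>energy_split\<close> is exactly the one in the
  variance identity at each exterior \<open>z\<close>.\<close>

lemma energy_H_ext:
  assumes ne: "D \<noteq> {}" and [measurable]: "u \<in> borel_measurable borel"
    and sq: "integrable lborel (\<lambda>x. indicator D x * (u x)\<^sup>2)"
  shows "energy j D (H_ext j D u) = (\<integral>\<^sup>+x\<in>D. (\<integral>\<^sup>+y\<in>D. (ennreal ((u x - u y)\<^sup>2) *
    (ennreal (kern j x y) + k_hat j D x y)) \<partial>lborel) \<partial>lborel)"
proof -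
  let ?q = "\<lambda>x y z. ennreal (kern j x z * kern j z y) / mu j D z"
  let ?s = "\<lambda>x y. ennreal ((u x - u y)\<^sup>2)"
  let ?T = "\<lambda>x y z. ?s x y * ?q x y z * indicator D y * indicator D x * indicator (- D) z"
  have k_hat_meas [measurable]: "(\<lambda>y. k_hat j D x y) \<in> borel_measurable borel" for x
    unfolding k_hat_def by measurable
  have k_hat_meas2 [measurable]: "(\<lambda>p. k_hat j D (fst p) (snd p)) \<in> borel_measurable (borel \<Otimes>\<^sub>M borel)"
    unfolding k_hat_def by measurable
  have int: "(\<integral>\<^sup>+x\<in>D. (\<integral>\<^sup>+y\<in>D. energy_density j (H_ext j D u) x y \<partial>lborel) \<partial>lborel) =
      (\<integral>\<^sup>+x\<in>D. (\<integral>\<^sup>+y\<in>D. (?s x y * ennreal (kern j x y)) \<partial>lborel) \<partial>lborel)"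
    by (auto intro!: nn_integral_cong simp: indicator_def energy_density_def H_ext_on_D)
  have "2 * (\<integral>\<^sup>+z\<in>- D. (\<integral>\<^sup>+x\<in>D. energy_density j (H_ext j D u) z x \<partial>lborel) \<partial>lborel) =
      (\<integral>\<^sup>+z. 2 * (\<integral>\<^sup>+x\<in>D. energy_density j (H_ext j D u) z x \<partial>lborel) * indicator (- D) z \<partial>lborel)"
    by (subst nn_integral_cmult[symmetric]) (simp_all add: mult.assoc)
  also have "\<dots> = (\<integral>\<^sup>+z. (\<integral>\<^sup>+x\<in>D. (\<integral>\<^sup>+y\<in>D. (?s x y * ?q x y z) \<partial>lborel) \<partial>lborel) * indicator (- D) z \<partial>lborel)"
    using AE_notin_frontier
  proof (intro nn_integral_cong_AE, eventually_elim)
    case (elim z)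
    then show ?case
      using exterior_energy_H_ext[OF ne closure_eq_outside_frontier assms(2) sq, of z]
      by (cases "z \<in> D") auto
  qed
  also have "\<dots> = (\<integral>\<^sup>+z. \<integral>\<^sup>+x. \<integral>\<^sup>+y. ?T x y z \<partial>lborel \<partial>lborel \<partial>lborel)"
    by (simp add: nn_integral_multc)
  \<comment> \<open>Two exchanges by Tonelli move \<open>z\<close> to the innermost place, where
    integrating it out produces \<open>k_hat\<close>.\<close>
  also have "\<dots> = (\<integral>\<^sup>+x. \<integral>\<^sup>+z. \<integral>\<^sup>+y. ?T x y z \<partial>lborel \<partial>lborel \<partial>lborel)"
    by (rule lborel_pair.Fubini') measurable
  also have "\<dots> = (\<integral>\<^sup>+x. \<integral>\<^sup>+y. \<integral>\<^sup>+z. ?T x y z \<partial>lborel \<partial>lborel \<partial>lborel)"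
    by (intro nn_integral_cong lborel_pair.Fubini') measurable
  also have "\<dots> = (\<integral>\<^sup>+x. \<integral>\<^sup>+y. ?s x y * k_hat j D x y * indicator D y * indicator D x \<partial>lborel \<partial>lborel)"
  proof (intro nn_integral_cong)
    fix x y
    have "(\<integral>\<^sup>+z. ?T x y z \<partial>lborel) =
        (\<integral>\<^sup>+z. (?s x y * indicator D y * indicator D x) * (?q x y z * indicator (- D) z) \<partial>lborel)"
      by (simp add: mult_ac)
    also have "\<dots> = (?s x y * indicator D y * indicator D x) * k_hat j D x y"
      unfolding k_hat_def by (rule nn_integral_cmult) measurable
    finally show "(\<integral>\<^sup>+z. ?T x y z \<partial>lborel) = ?s x y * k_hat j D x y * indicator D y * indicator D x"
      by (simp add: mult_ac)
  qed
  also have "\<dots> = (\<integral>\<^sup>+x\<in>D. (\<integral>\<^sup>+y\<in>D. (?s x y * k_hat j D x y) \<partial>lborel) \<partial>lborel)"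
    by (simp add: nn_integral_multc)
  finally show ?thesis
    unfolding energy_split[OF H_ext_measurable[OF assms(2)]] int
    by (simp add: distrib_left distrib_right nn_integral_add)
qed

section \<open>Independence of the representative and the final formula\<close>

lemma E_hat_H_ext:
  assumes u: "u \<in> ext_dom j D"
    and \<phi>: "integrable (restrict_space lborel D) (\<lambda>x. (\<phi> x)\<^sup>2)"
    and eq: "AE x in restrict_space lborel D. \<phi> x = u x"
  shows "E_hat j D (H_ext j D u) (H_ext j D u) \<ge> 0"
    and "ennreal (2 * E_hat j D (H_ext j D u) (H_ext j D u)) =
      (\<integral>\<^sup>+x\<in>D. (\<integral>\<^sup>+y\<in>D. (ennreal ((\<phi> x - \<phi> y)\<^sup>2) *
        (ennreal (kern j x y) + k_hat j D x y)) \<partial>lborel) \<partial>lborel)" (is "_ = ?R \<phi>")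
proof -
  note u_meas [measurable] = ext_dom_measurable[OF u]
  have AE_D: "AE x in lborel. x \<in> D \<longrightarrow> \<phi> x = u x"
    using eq by (subst (asm) AE_restrict_space_iff) auto
  \<comment> \<open>\<open>ext_dom\<close> does not ask for square integrability; it is inherited
    from \<phi>.\<close>
  have sq: "integrable lborel (\<lambda>x. indicator D x * (u x)\<^sup>2)"
  proof (rule integrable_cong_AE_imp)
    show "integrable lborel (\<lambda>x. indicator D x * (\<phi> x)\<^sup>2)"
      using \<phi> by (subst (asm) integrable_restrict_space) (auto simp: set_integrable_def)
    show "AE x in lborel. indicator D x * (\<phi> x)\<^sup>2 = indicator D x * (u x)\<^sup>2"
      using AE_D by eventually_elim (auto simp: indicator_def)
  qed measurable
  \<comment> \<open>The exceptional null set is discarded once in each variable; almost-everywhere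
    congruence asks for no measurability of \<phi>.\<close>
  have R: "?R u = ?R \<phi>"
  proof (rule nn_integral_cong_AE)
    show "AE x in lborel.
      (\<integral>\<^sup>+y\<in>D. (ennreal ((u x - u y)\<^sup>2) * (ennreal (kern j x y) + k_hat j D x y)) \<partial>lborel) * indicator D x =
      (\<integral>\<^sup>+y\<in>D. (ennreal ((\<phi> x - \<phi> y)\<^sup>2) * (ennreal (kern j x y) + k_hat j D x y)) \<partial>lborel) * indicator D x"
      using AE_D
    proof eventually_elim
      case (elim x)
      have "(\<integral>\<^sup>+y\<in>D. (ennreal ((u x - u y)\<^sup>2) * (ennreal (kern j x y) + k_hat j D x y)) \<partial>lborel) =
        (\<integral>\<^sup>+y\<in>D. (ennreal ((u x - \<phi> y)\<^sup>2) * (ennreal (kern j x y) + k_hat j D x y)) \<partial>lborel)"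
        using AE_D by (intro nn_integral_cong_AE, eventually_elim) (auto simp: indicator_def)
      with elim show ?case
        by (auto simp: indicator_def)
    qed
  qed
  have energy: "energy j D (H_ext j D u) < \<infinity> \<and> energy j D (H_ext j D u) = ?R u"
  \<comment> \<open>For empty \<open>D\<close> the weight \<open>mu\<close> is identically 0 and
    \<open>mu_pos\<close> fails, but both sides vanish.\<close>
  proof (cases "D = {}")
    case True
    then show ?thesis
      by (simp add: energy_def)
  next
    case False
    have "energy j D (H_ext j D u) \<le> energy j D u"
      by (rule energy_H_ext_le[OF False u_meas sq])
    also have "\<dots> < \<infinity>"
      by (rule energy_ext_dom_finite[OF u False])
    finally show ?thesis
      using energy_H_ext[OF False u_meas sq] by simp
  qed
  show "E_hat j D (H_ext j D u) (H_ext j D u) \<ge> 0"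
    using energy by (intro energy_eq_E_hat(2)) auto
  show "ennreal (2 * E_hat j D (H_ext j D u) (H_ext j D u)) = ?R \<phi>"
    using energy energy_eq_E_hat(1)[OF H_ext_measurable[OF u_meas]] R by metis
qed

end

theorem mainTheorem5:
  fixes j :: "real \<Rightarrow> real" and D :: "(real ^ 'n) set" and \<phi> :: "real ^ 'n \<Rightarrow> real"
  assumes "CARD('n) \<ge> 2"
    and "\<And>r. r > 0 \<Longrightarrow> j r > 0"
    and "antimono_on {0<..} j"
    and "(\<integral>\<^sup>+x. ennreal (min 1 ((norm x)\<^sup>2) * j (norm x)) \<partial>(lborel :: (real ^ 'n) measure)) < \<infinity>"
    and "bounded D" and "open D"
    and "frontier D \<in> null_sets lborel"
    and "\<phi> \<in> check_dom j D"
  shows "ennreal (E_check j D \<phi>) =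
    1 / 2 * (\<integral>\<^sup>+x\<in>D. (\<integral>\<^sup>+y\<in>D. (ennreal ((\<phi> x - \<phi> y)\<^sup>2) *
                (ennreal (kern j x y) + k_hat j D x y)) \<partial>lborel) \<partial>lborel)"
proof -
  interpret radial_kernel j D
    using assms by unfold_locales auto
  let ?R = "\<integral>\<^sup>+x\<in>D. (\<integral>\<^sup>+y\<in>D. (ennreal ((\<phi> x - \<phi> y)\<^sup>2) *
    (ennreal (kern j x y) + k_hat j D x y)) \<partial>lborel) \<partial>lborel"
  let ?E = "\<lambda>u. E_hat j D (H_ext j D u) (H_ext j D u)"
  have sq: "integrable (restrict_space lborel D) (\<lambda>x. (\<phi> x)\<^sup>2)"
    using assms(8) by (simp add: check_dom_def)
  obtain u where u: "u \<in> ext_dom j D" "AE x in restrict_space lborel D. \<phi> x = u x"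
    using assms(8) by (auto simp: check_dom_def)
  \<comment> \<open>Both values are given by the same integral of \<phi>, so the definite
    description in \<open>E_check\<close> is well defined. Nonnegativity lets \<open>ennreal\<close>
    be cancelled.\<close>
  have "?E v = ?E u" if "v \<in> ext_dom j D" "AE x in restrict_space lborel D. \<phi> x = v x" for v
  proof -
    have "ennreal (2 * ?E v) = ennreal (2 * ?E u)"
      using E_hat_H_ext(2)[OF that(1) sq that(2)] E_hat_H_ext(2)[OF u(1) sq u(2)] by simp
    then show ?thesis
      using E_hat_H_ext(1)[OF that(1) sq that(2)] E_hat_H_ext(1)[OF u(1) sq u(2)] by simp
  qed
  then have "E_check j D \<phi> = ?E u"
    unfolding E_check_def using u by (intro the_equality) blast+
  moreover have "ennreal (?E u) = 1 / 2 * ennreal (2 * ?E u)"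
  proof -
    \<comment> \<open>The \<open>1 / 2\<close> of the statement is a quotient in
      \<open>ennreal\<close>; it must be identified with the image of the real number.\<close>
    have "ennreal (1 / 2) = 1 / 2"
      by (subst divide_ennreal[symmetric]) simp_all
    then have "1 / 2 * ennreal (2 * ?E u) = ennreal (1 / 2) * ennreal (2 * ?E u)"
      by simp
    also have "\<dots> = ennreal (?E u)"
      using E_hat_H_ext(1)[OF u(1) sq u(2)] by (subst ennreal_mult[symmetric]) auto
    finally show ?thesis ..
  qed
  ultimately show ?thesis
    using E_hat_H_ext(2)[OF u(1) sq u(2)] by simp
qed

end
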